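(* Let $F$ be a field, $K/F$ a finite field extension, $c\in K^\times$, $\sigma_1,\sigma_2,\sigma_3,\sigma_4\in\mathrm{Aut}_F(K)$ and $A_K=\mathrm{Cay}(K,c,\sigma_1,\sigma_2,\sigma_3,\sigma_4)$. Suppose that at least one of $\mathrm{Nuc}_l(A_K)$, $\mathrm{Nuc}_m(A_K)$, $\mathrm{Nuc}_r(A_K)$ is equal to $K$. Then $G:A_K\to A_K$ is an automorphism of $A_K$ if and only if $G$ has the form $G(u,v)=(g(u),h(v)b)$ for some $g,h\in\mathrm{Aut}_F(K)$ such that $g\circ f=f\circ h$ for $f=\sigma_1,\sigma_2,\sigma_3^{-1},\sigma_4^{-1}$ and some $b\in K^\times$ such that $g(c)=\sigma_1(b)\sigma_2(b)c$.
   Context: $\mathrm{Cay}(K,c,\sigma_1,\sigma_2,\sigma_3,\sigma_4)$ denotes the $F$-vector space $K\oplus K$ with the (not necessarily associative) multiplication $(u,v)(x,y)=(ux+c\sigma_1(v)\sigma_2(y),\ \sigma_3(u)y+v\sigma_4(x))$; $K$ is identified with the subalgebra $K\oplus0$. Automorphisms are $F$-algebra automorphisms. For an algebra $A$ with associator $[x,y,z]=(xy)z-x(yz)$, $\mathrm{Nuc}_l(A)=\{x\in A\mid[x,A,A]=0\}$, $\mathrm{Nuc}_m(A)=\{x\in A\mid[A,x,A]=0\}$, $\mathrm{Nuc}_r(A)=\{x\in A\mid[A,A,x]=0\}$. *)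

theory Defs
  imports "HOL-Algebra.Embedded_Algebras"
begin

text \<open>
  Nonassociative algebras are carried by records of type \<open>('a, 'b) module\<close>, whose
  multiplication is subject to no axioms. A field extension is a field \<open>K\<close> together with
  a subfield \<open>F\<close>, which is a subset of \<open>carrier K\<close>.
\<close>

definition field_aut :: "'a set \<Rightarrow> ('a, 'm) ring_scheme \<Rightarrow> ('a \<Rightarrow> 'a) set" where
  "field_aut F K = {s \<in> ring_iso K K. \<forall>a\<in>F. s a = a}"

definition alg_aut :: "'a set \<Rightarrow> ('a, 'b, 'm) module_scheme \<Rightarrow> ('b \<Rightarrow> 'b) set" where
  "alg_aut F A = {f. bij_betw f (carrier A) (carrier A)
     \<and> (\<forall>x\<in>carrier A. \<forall>y\<in>carrier A. f (x \<oplus>\<^bsub>A\<^esub> y) = f x \<oplus>\<^bsub>A\<^esub> f y)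
     \<and> (\<forall>a\<in>F. \<forall>x\<in>carrier A. f (a \<odot>\<^bsub>A\<^esub> x) = a \<odot>\<^bsub>A\<^esub> f x)
     \<and> (\<forall>x\<in>carrier A. \<forall>y\<in>carrier A. f (x \<otimes>\<^bsub>A\<^esub> y) = f x \<otimes>\<^bsub>A\<^esub> f y)}"

definition associator :: "('b, 'm) ring_scheme \<Rightarrow> 'b \<Rightarrow> 'b \<Rightarrow> 'b \<Rightarrow> 'b" where
  "associator A x y z = ((x \<otimes>\<^bsub>A\<^esub> y) \<otimes>\<^bsub>A\<^esub> z) \<ominus>\<^bsub>A\<^esub> (x \<otimes>\<^bsub>A\<^esub> (y \<otimes>\<^bsub>A\<^esub> z))"

definition Nuc_l :: "('b, 'm) ring_scheme \<Rightarrow> 'b set" where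
  "Nuc_l A = {x \<in> carrier A. \<forall>y\<in>carrier A. \<forall>z\<in>carrier A. associator A x y z = \<zero>\<^bsub>A\<^esub>}"

definition Nuc_m :: "('b, 'm) ring_scheme \<Rightarrow> 'b set" where
  "Nuc_m A = {x \<in> carrier A. \<forall>y\<in>carrier A. \<forall>z\<in>carrier A. associator A y x z = \<zero>\<^bsub>A\<^esub>}"

definition Nuc_r :: "('b, 'm) ring_scheme \<Rightarrow> 'b set" where
  "Nuc_r A = {x \<in> carrier A. \<forall>y\<in>carrier A. \<forall>z\<in>carrier A. associator A y z x = \<zero>\<^bsub>A\<^esub>}"

text \<open>
  Scalars act componentwise. The record does not mention \<open>F\<close>: the \<open>F\<close>-vector space structure
  is obtained by letting only elements of \<open>F\<close> act.
\<close>

definition Cay ::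
    "('a, 'm) ring_scheme \<Rightarrow> 'a \<Rightarrow> ('a \<Rightarrow> 'a) \<Rightarrow> ('a \<Rightarrow> 'a) \<Rightarrow> ('a \<Rightarrow> 'a) \<Rightarrow> ('a \<Rightarrow> 'a)
      \<Rightarrow> ('a, 'a \<times> 'a) module" where
  "Cay K c \<sigma>1 \<sigma>2 \<sigma>3 \<sigma>4 =
     \<lparr> carrier = carrier K \<times> carrier K,
       mult = (\<lambda>(u, v) (x, y).
         (u \<otimes>\<^bsub>K\<^esub> x \<oplus>\<^bsub>K\<^esub> c \<otimes>\<^bsub>K\<^esub> \<sigma>1 v \<otimes>\<^bsub>K\<^esub> \<sigma>2 y, \<sigma>3 u \<otimes>\<^bsub>K\<^esub> y \<oplus>\<^bsub>K\<^esub> v \<otimes>\<^bsub>K\<^esub> \<sigma>4 x)),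
       one = (\<one>\<^bsub>K\<^esub>, \<zero>\<^bsub>K\<^esub>),
       zero = (\<zero>\<^bsub>K\<^esub>, \<zero>\<^bsub>K\<^esub>),
       add = (\<lambda>(u, v) (x, y). (u \<oplus>\<^bsub>K\<^esub> x, v \<oplus>\<^bsub>K\<^esub> y)),
       smult = (\<lambda>a (u, v). (a \<otimes>\<^bsub>K\<^esub> u, a \<otimes>\<^bsub>K\<^esub> v)) \<rparr>"

definition embedded_field :: "('a, 'm) ring_scheme \<Rightarrow> ('a \<times> 'a) set" where
  "embedded_field K = carrier K \<times> {\<zero>\<^bsub>K\<^esub>}"

lemma Cay_module:
  assumes "field K" "subfield F K"
  shows "module (K\<lparr>carrier := F\<rparr>) (Cay K c \<sigma>1 \<sigma>2 \<sigma>3 \<sigma>4)"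
proof -
  interpret field K by fact
  have sub: "F \<subseteq> carrier K"
    using assms(2) subfieldE(3) by blast
  show ?thesis
  proof (rule moduleI)
    show "cring (K\<lparr>carrier := F\<rparr>)"
      using subfield_iff(2)[OF assms(2)] by (simp add: field_def domain_def)
    show "abelian_group (Cay K c \<sigma>1 \<sigma>2 \<sigma>3 \<sigma>4)"
    proof (rule abelian_groupI)
      fix x assume "x \<in> carrier (Cay K c \<sigma>1 \<sigma>2 \<sigma>3 \<sigma>4)"
      then show "\<exists>y\<in>carrier (Cay K c \<sigma>1 \<sigma>2 \<sigma>3 \<sigma>4).
          y \<oplus>\<^bsub>Cay K c \<sigma>1 \<sigma>2 \<sigma>3 \<sigma>4\<^esub> x = \<zero>\<^bsub>Cay K c \<sigma>1 \<sigma>2 \<sigma>3 \<sigma>4\<^esub>"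
        by (intro bexI[of _ "(\<ominus>\<^bsub>K\<^esub> fst x, \<ominus>\<^bsub>K\<^esub> snd x)"]) (auto simp: Cay_def l_neg)
    qed (auto simp: Cay_def a_ac)
  qed (use sub in \<open>auto simp: Cay_def l_distr r_distr m_assoc subset_iff\<close>)
qed

end

theory Submission
  imports Defs
begin

text \<open>
  Write \<open>A\<close> for the algebra and \<open>K\<close> for its subalgebra \<open>K \<oplus> 0\<close>. The nuclei of \<open>A\<close> are
  characterised by the multiplication alone, so an automorphism \<open>G\<close> maps each of them onto
  itself; the assumption on the nuclei therefore forces \<open>G\<close> to restrict to an automorphism \<open>g\<close>
  of \<open>K\<close>. Put \<open>G (0, 1) = (a, b)\<close>. Since \<open>(0, v)\<close> equals both \<open>(\<sigma>3\<^sup>-\<^sup>1 v, 0) (0, 1)\<close> and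
  \<open>(0, 1) (\<sigma>4\<^sup>-\<^sup>1 v, 0)\<close>, the map \<open>G\<close> is determined by \<open>g\<close>, \<open>a\<close> and \<open>b\<close>, namely
  \<open>G (0, v) = (g (\<sigma>3\<^sup>-\<^sup>1 v) a, h v b)\<close> with \<open>h = \<sigma>3 g \<sigma>3\<^sup>-\<^sup>1\<close>, and comparing the two expressions
  also gives \<open>h = \<sigma>4 g \<sigma>4\<^sup>-\<^sup>1\<close>. Injectivity yields \<open>b \<noteq> 0\<close>.

  The heart of the matter is \<open>a = 0\<close>. Applying \<open>G\<close> to \<open>(0, v) (0, y) = (c \<sigma>1(v) \<sigma>2(y), 0)\<close> gives
  \<open>a\<^sup>2 g \<sigma>3\<^sup>-\<^sup>1(v) g \<sigma>3\<^sup>-\<^sup>1(y) + c \<sigma>1(b) \<sigma>2(b) \<sigma>1 h(v) \<sigma>2 h(y) = g(c) g \<sigma>1(v) g \<sigma>2(y)\<close>.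
  With \<open>y = 1\<close> or \<open>v = 1\<close> this is a linear relation between three characters of \<open>K\<close>. If
  \<open>a \<noteq> 0\<close>, Dedekind's independence of characters (\<open>three_characters_agree\<close>) forces
  \<open>\<sigma>1 = \<sigma>2 = \<sigma>3\<^sup>-\<^sup>1\<close>, and the two formulas for \<open>G (0, v)\<close> force \<open>\<sigma>3 = \<sigma>4\<close>. But then the
  substitution \<open>v = \<sigma>3 w\<close> identifies \<open>A\<close> with \<open>K[X] / (X\<^sup>2 - c)\<close>, which is associative
  (\<open>Cay_assoc\<close>), so that all three nuclei are \<open>A\<close> and none is \<open>K\<close>. This argument is uniform in
  the characteristic. Once \<open>a = 0\<close>, the same relation reads
  \<open>\<sigma>1 h (v) \<sigma>2 h (y) = g \<sigma>1 (v) g \<sigma>2 (y)\<close>, together with \<open>g c = \<sigma>1(b) \<sigma>2(b) c\<close>.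

  The converse is a direct computation, in which the conditions at \<open>\<sigma>3\<^sup>-\<^sup>1\<close> and \<open>\<sigma>4\<^sup>-\<^sup>1\<close> are used
  in the form \<open>h \<sigma>3 = \<sigma>3 g\<close> and \<open>h \<sigma>4 = \<sigma>4 g\<close>.
\<close>

section \<open>Nuclei of nonassociative algebras\<close>

lemma (in abelian_group) associator_eq_zero_iff:
  assumes "\<And>x y. x \<in> carrier G \<Longrightarrow> y \<in> carrier G \<Longrightarrow> x \<otimes> y \<in> carrier G"
    and "x \<in> carrier G" "y \<in> carrier G" "z \<in> carrier G"
  shows "associator G x y z = \<zero> \<longleftrightarrow> (x \<otimes> y) \<otimes> z = x \<otimes> (y \<otimes> z)"
proof -
  have eq: "x = y" if "x \<ominus> y = \<zero>" "x \<in> carrier G" "y \<in> carrier G" for x y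
    using that minus_equality[of x "\<ominus> y"] by (simp add: a_minus_def)
  have cl: "(x \<otimes> y) \<otimes> z \<in> carrier G" "x \<otimes> (y \<otimes> z) \<in> carrier G"
    using assms by auto
  show ?thesis
    unfolding associator_def using eq[OF _ cl] cl by (auto simp: a_minus_def r_neg)
qed

text \<open>
  An automorphism preserves and reflects the vanishing of associators, and it permutes the
  elements over which the other two arguments of the associator range.
\<close>

lemma alg_aut_image_Nuc:
  fixes A (structure)
  assumes A: "abelian_group A"
    and closed: "\<And>x y. x \<in> carrier A \<Longrightarrow> y \<in> carrier A \<Longrightarrow> x \<otimes> y \<in> carrier A"
    and f: "f \<in> alg_aut F A"
  shows "f ` Nuc_l A = Nuc_l A" "f ` Nuc_m A = Nuc_m A" "f ` Nuc_r A = Nuc_r A"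
proof -
  interpret abelian_group A by (rule A)
  have bij: "bij_betw f (carrier A) (carrier A)"
    and mult: "\<And>x y. x \<in> carrier A \<Longrightarrow> y \<in> carrier A \<Longrightarrow> f (x \<otimes> y) = f x \<otimes> f y"
    using f by (auto simp: alg_aut_def)
  have im: "f ` carrier A = carrier A" and inj: "inj_on f (carrier A)"
    using bij by (auto simp: bij_betw_def)
  have fc: "f x \<in> carrier A" if "x \<in> carrier A" for x
    using that im by blast
  have assoc: "associator A (f x) (f y) (f z) = \<zero> \<longleftrightarrow> associator A x y z = \<zero>"
    if "x \<in> carrier A" "y \<in> carrier A" "z \<in> carrier A" for x y z
  proof -
    have "associator A (f x) (f y) (f z) = \<zero> \<longleftrightarrow> f ((x \<otimes> y) \<otimes> z) = f (x \<otimes> (y \<otimes> z))"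
      using that by (simp add: associator_eq_zero_iff closed fc mult)
    also have "\<dots> \<longleftrightarrow> (x \<otimes> y) \<otimes> z = x \<otimes> (y \<otimes> z)"
      using that by (intro inj_on_eq_iff[OF inj]) (auto simp: closed)
    finally show ?thesis
      using that by (simp add: associator_eq_zero_iff closed)
  qed
  have ball: "(\<forall>y\<in>carrier A. P y) \<longleftrightarrow> (\<forall>y\<in>carrier A. P (f y))" for P
    by (subst (1) im[symmetric]) simp
  have image: "f ` {x \<in> carrier A. P x} = {x \<in> carrier A. P x}"
    if "\<And>x. x \<in> carrier A \<Longrightarrow> P (f x) \<longleftrightarrow> P x" for P
  proof -
    have "y \<in> f ` {x \<in> carrier A. P x}" if "y \<in> carrier A" "P y" for y
    proof -
      obtain x where "x \<in> carrier A" "y = f x"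
        using im \<open>y \<in> carrier A\<close> by blast
      then show ?thesis
        using \<open>P y\<close> \<open>\<And>x. x \<in> carrier A \<Longrightarrow> P (f x) \<longleftrightarrow> P x\<close> by blast
    qed
    then show ?thesis
      using that fc by auto
  qed
  show "f ` Nuc_l A = Nuc_l A"
    unfolding Nuc_l_def
    by (rule image, subst ball, subst (2) ball) (simp add: assoc)
  show "f ` Nuc_m A = Nuc_m A"
    unfolding Nuc_m_def
    by (rule image, subst ball, subst (2) ball) (simp add: assoc)
  show "f ` Nuc_r A = Nuc_r A"
    unfolding Nuc_r_def
    by (rule image, subst ball, subst (2) ball) (simp add: assoc)
qed

section \<open>A linear relation between three characters\<close>

text \<open>
  This is the case of Dedekind's theorem that is needed; for characters with value \<open>1\<close> at \<open>1\<close>, the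
  coefficient of \<open>\<chi>3\<close> in any such relation is the sum of the other two. Subtracting \<open>\<chi>3 z\<close> times the relation at \<open>y\<close> from the relation
  at \<open>y z\<close> eliminates \<open>\<chi>3 y\<close>; the relation at \<open>z\<close> then turns the result into
  \<open>\<alpha> (\<chi>1 z - \<chi>3 z) (\<chi>1 y - \<chi>2 y) = 0\<close>. So if \<open>\<chi>1\<close> and \<open>\<chi>3\<close> differ at \<open>z\<close>, then \<open>\<chi>1 = \<chi>2\<close>, and
  the relation itself collapses to \<open>(\<alpha> + \<beta>) \<chi>1 = (\<alpha> + \<beta>) \<chi>3\<close>.
\<close>

lemma (in domain) three_characters_agree:
  assumes hom: "\<chi>1 \<in> hom R R" "\<chi>2 \<in> hom R R" "\<chi>3 \<in> hom R R"
    and \<alpha>: "\<alpha> \<in> carrier R" "\<alpha> \<noteq> \<zero>" and \<beta>: "\<beta> \<in> carrier R" and sum: "\<alpha> \<oplus> \<beta> \<noteq> \<zero>"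
    and rel: "\<And>x. x \<in> carrier R \<Longrightarrow> \<alpha> \<otimes> \<chi>1 x \<oplus> \<beta> \<otimes> \<chi>2 x = (\<alpha> \<oplus> \<beta>) \<otimes> \<chi>3 x"
    and z: "z \<in> carrier R"
  shows "\<chi>1 z = \<chi>3 z"
proof (rule ccontr)
  assume neq: "\<chi>1 z \<noteq> \<chi>3 z"
  note cl = hom_in_carrier[OF hom(1)] hom_in_carrier[OF hom(2)] hom_in_carrier[OF hom(3)]
  have *: "\<chi>1 y = \<chi>2 y" if y: "y \<in> carrier R" for y
  proof -
    note cls [simp] = \<alpha>(1) \<beta> cl[OF y] cl[OF z]
    have "\<alpha> \<otimes> (\<chi>1 z \<ominus> \<chi>3 z) \<oplus> \<beta> \<otimes> (\<chi>2 z \<ominus> \<chi>3 z)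
        = (\<alpha> \<otimes> \<chi>1 z \<oplus> \<beta> \<otimes> \<chi>2 z) \<ominus> (\<alpha> \<oplus> \<beta>) \<otimes> \<chi>3 z"
      using cls by algebra
    then have rel_z: "\<alpha> \<otimes> (\<chi>1 z \<ominus> \<chi>3 z) \<oplus> \<beta> \<otimes> (\<chi>2 z \<ominus> \<chi>3 z) = \<zero>"
      using rel[OF z] by (simp add: a_minus_def r_neg)
    have "\<alpha> \<otimes> \<chi>1 y \<otimes> (\<chi>1 z \<ominus> \<chi>3 z) \<oplus> \<beta> \<otimes> \<chi>2 y \<otimes> (\<chi>2 z \<ominus> \<chi>3 z)
        = (\<alpha> \<otimes> (\<chi>1 y \<otimes> \<chi>1 z) \<oplus> \<beta> \<otimes> (\<chi>2 y \<otimes> \<chi>2 z)) \<ominus> (\<alpha> \<otimes> \<chi>1 y \<oplus> \<beta> \<otimes> \<chi>2 y) \<otimes> \<chi>3 z"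
      using cls by algebra
    also have "\<dots> = (\<alpha> \<oplus> \<beta>) \<otimes> (\<chi>3 y \<otimes> \<chi>3 z) \<ominus> (\<alpha> \<oplus> \<beta>) \<otimes> \<chi>3 y \<otimes> \<chi>3 z"
      using rel[of "y \<otimes> z"] rel[OF y] y z
      by (simp add: hom_mult[OF hom(1)] hom_mult[OF hom(2)] hom_mult[OF hom(3)])
    also have "\<dots> = \<zero>"
      by (simp add: m_assoc a_minus_def r_neg)
    finally have rel_yz:
      "\<alpha> \<otimes> \<chi>1 y \<otimes> (\<chi>1 z \<ominus> \<chi>3 z) \<oplus> \<beta> \<otimes> \<chi>2 y \<otimes> (\<chi>2 z \<ominus> \<chi>3 z) = \<zero>" .
    have "\<alpha> \<otimes> (\<chi>1 z \<ominus> \<chi>3 z) \<otimes> (\<chi>1 y \<ominus> \<chi>2 y)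
        = (\<alpha> \<otimes> \<chi>1 y \<otimes> (\<chi>1 z \<ominus> \<chi>3 z) \<oplus> \<beta> \<otimes> \<chi>2 y \<otimes> (\<chi>2 z \<ominus> \<chi>3 z))
          \<ominus> \<chi>2 y \<otimes> (\<alpha> \<otimes> (\<chi>1 z \<ominus> \<chi>3 z) \<oplus> \<beta> \<otimes> (\<chi>2 z \<ominus> \<chi>3 z))"
      using cls by algebra
    also have "\<dots> = \<zero>"
      unfolding rel_z rel_yz by simp
    finally show ?thesis
      using \<alpha>(2) neq by (simp add: integral_iff)
  qed
  have "(\<alpha> \<oplus> \<beta>) \<otimes> \<chi>1 z = (\<alpha> \<oplus> \<beta>) \<otimes> \<chi>3 z"
    using rel[OF z] *[OF z] \<alpha> \<beta> z cl by (simp add: l_distr)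
  then show False
    using neq sum \<alpha> \<beta> z cl by (simp add: m_lcancel)
qed

section \<open>Field automorphisms over a subfield\<close>

lemma field_aut_compose:
  assumes "s \<in> field_aut F K" "t \<in> field_aut F K"
  shows "s \<circ> t \<in> field_aut F K"
  using assms by (auto simp: field_aut_def intro: ring_iso_set_trans)

lemma field_aut_inv_into:
  assumes "field K" "F \<subseteq> carrier K" "s \<in> field_aut F K"
  shows "inv_into (carrier K) s \<in> field_aut F K"
proof -
  interpret field K by fact
  have s: "s \<in> ring_iso K K" "\<And>a. a \<in> F \<Longrightarrow> s a = a"
    using assms(3) by (auto simp: field_aut_def)
  have "inv_into (carrier K) s a = a" if "a \<in> F" for a
    using that s assms(2) by (intro inv_into_f_eq) (auto simp: ring_iso_def bij_betw_def)
  then show ?thesis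
    using s ring_iso_set_sym[OF ring_axioms] by (auto simp: field_aut_def)
qed

section \<open>Automorphisms of the doubled field\<close>

locale cay_algebra = field K for K (structure) +
  fixes F :: "'a set" and c :: 'a and \<sigma>1 \<sigma>2 \<sigma>3 \<sigma>4 :: "'a \<Rightarrow> 'a"
  assumes subfield_F: "subfield F K"
    and c_carrier [simp]: "c \<in> carrier K" and c_nonzero [simp]: "c \<noteq> \<zero>"
    and \<sigma>1 [simp]: "\<sigma>1 \<in> field_aut F K" and \<sigma>2 [simp]: "\<sigma>2 \<in> field_aut F K"
    and \<sigma>3 [simp]: "\<sigma>3 \<in> field_aut F K" and \<sigma>4 [simp]: "\<sigma>4 \<in> field_aut F K"
begin

abbreviation A\<^sub>K where "A\<^sub>K \<equiv> Cay K c \<sigma>1 \<sigma>2 \<sigma>3 \<sigma>4"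

abbreviation \<tau>3 where "\<tau>3 \<equiv> inv_into (carrier K) \<sigma>3"
abbreviation \<tau>4 where "\<tau>4 \<equiv> inv_into (carrier K) \<sigma>4"

lemma F_sub: "F \<subseteq> carrier K"
  using subfield_F subfieldE(3) by blast

lemma \<tau>_field_aut [simp]: "\<tau>3 \<in> field_aut F K" "\<tau>4 \<in> field_aut F K"
  by (auto intro!: field_aut_inv_into field_axioms F_sub)

text \<open>
  The left-hand sides have a variable head \<open>s\<close> and match every application, so only the instances at
  particular automorphisms serve as rewrite rules.
\<close>

lemma field_aut_simps:
  assumes "s \<in> field_aut F K"
  shows "x \<in> carrier K \<Longrightarrow> s x \<in> carrier K"
    and "x \<in> carrier K \<Longrightarrow> y \<in> carrier K \<Longrightarrow> s (x \<otimes> y) = s x \<otimes> s y"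
    and "x \<in> carrier K \<Longrightarrow> y \<in> carrier K \<Longrightarrow> s (x \<oplus> y) = s x \<oplus> s y"
    and "s \<one> = \<one>" and "s \<zero> = \<zero>"
    and "x \<in> carrier K \<Longrightarrow> y \<in> carrier K \<Longrightarrow> s x = s y \<longleftrightarrow> x = y"
    and "x \<in> carrier K \<Longrightarrow> s x = \<zero> \<longleftrightarrow> x = \<zero>"
    and "s ` carrier K = carrier K"
    and "a \<in> F \<Longrightarrow> s a = a"
proof -
  have hom: "s \<in> ring_hom K K" and bij: "bij_betw s (carrier K) (carrier K)"
    using assms by (auto simp: field_aut_def ring_iso_def)
  interpret ring_hom_ring K K s
    by (rule ring_hom_ringI2[OF ring_axioms ring_axioms hom])
  show "x \<in> carrier K \<Longrightarrow> s x \<in> carrier K"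
    and "x \<in> carrier K \<Longrightarrow> y \<in> carrier K \<Longrightarrow> s (x \<otimes> y) = s x \<otimes> s y"
    and "x \<in> carrier K \<Longrightarrow> y \<in> carrier K \<Longrightarrow> s (x \<oplus> y) = s x \<oplus> s y"
    and "s \<one> = \<one>" and "s \<zero> = \<zero>"
    by simp_all
  show eq: "x \<in> carrier K \<Longrightarrow> y \<in> carrier K \<Longrightarrow> s x = s y \<longleftrightarrow> x = y" for x y
    by (rule inj_on_eq_iff[OF bij_betw_imp_inj_on[OF bij]])
  show "x \<in> carrier K \<Longrightarrow> s x = \<zero> \<longleftrightarrow> x = \<zero>"
    using eq[of x \<zero>] by simp
  show "s ` carrier K = carrier K"
    using bij by (auto simp: bij_betw_def)
  show "a \<in> F \<Longrightarrow> s a = a"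
    using assms by (auto simp: field_aut_def)
qed

lemmas automorphism_simps [simp] =
  field_aut_simps[OF \<sigma>1] field_aut_simps[OF \<sigma>2] field_aut_simps[OF \<sigma>3] field_aut_simps[OF \<sigma>4]
  field_aut_simps[OF \<tau>_field_aut(1)] field_aut_simps[OF \<tau>_field_aut(2)]

lemma field_aut_hom: "s \<in> field_aut F K \<Longrightarrow> s \<in> hom K K"
  by (auto simp: hom_def field_aut_simps)

lemma \<tau>_inverse [simp]:
  assumes "x \<in> carrier K"
  shows "\<sigma>3 (\<tau>3 x) = x" "\<sigma>4 (\<tau>4 x) = x" "\<tau>3 (\<sigma>3 x) = x" "\<tau>4 (\<sigma>4 x) = x"
  using assms
  by (auto simp: f_inv_into_f intro!: inv_into_f_f inj_onI)

lemma Cay_simps [simp]: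
  "carrier A\<^sub>K = carrier K \<times> carrier K"
  "(u, v) \<otimes>\<^bsub>A\<^sub>K\<^esub> (x, y) = (u \<otimes> x \<oplus> c \<otimes> \<sigma>1 v \<otimes> \<sigma>2 y, \<sigma>3 u \<otimes> y \<oplus> v \<otimes> \<sigma>4 x)"
  "(u, v) \<oplus>\<^bsub>A\<^sub>K\<^esub> (x, y) = (u \<oplus> x, v \<oplus> y)"
  "a \<odot>\<^bsub>A\<^sub>K\<^esub> (u, v) = (a \<otimes> u, a \<otimes> v)"
  by (auto simp: Cay_def)

lemma Cay_mult_closed:
  "x \<in> carrier A\<^sub>K \<Longrightarrow> y \<in> carrier A\<^sub>K \<Longrightarrow> x \<otimes>\<^bsub>A\<^sub>K\<^esub> y \<in> carrier A\<^sub>K"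
  by auto

lemma abelian_group_Cay: "abelian_group A\<^sub>K"
  using Cay_module[OF field_axioms subfield_F] by (rule module.axioms(2))

text \<open>
  In this case \<open>(u, w) \<mapsto> (u, \<sigma>3 w)\<close> is an isomorphism from \<open>K[X] / (X\<^sup>2 - c)\<close>, with \<open>(u, w)\<close> standing
  for \<open>u + w X\<close>, onto the algebra.
\<close>

lemma Cay_assoc:
  assumes inv: "\<And>x. x \<in> carrier K \<Longrightarrow> \<sigma>1 x = \<tau>3 x" "\<And>x. x \<in> carrier K \<Longrightarrow> \<sigma>2 x = \<tau>3 x"
    "\<And>x. x \<in> carrier K \<Longrightarrow> \<sigma>4 x = \<sigma>3 x"
    and "x \<in> carrier A\<^sub>K" "y \<in> carrier A\<^sub>K" "z \<in> carrier A\<^sub>K"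
  shows "(x \<otimes>\<^bsub>A\<^sub>K\<^esub> y) \<otimes>\<^bsub>A\<^sub>K\<^esub> z = x \<otimes>\<^bsub>A\<^sub>K\<^esub> (y \<otimes>\<^bsub>A\<^sub>K\<^esub> z)"
  using assms(4-) by (auto simp: inv l_distr r_distr m_ac a_ac)

text \<open>
  The nucleus condition enters twice: it makes \<open>K \<oplus> 0\<close> invariant under \<open>G\<close>, and it excludes the
  associative algebra in which \<open>G (0, 1)\<close> could have a nonzero first component \<open>a\<close>.
\<close>

lemma alg_aut_normal_form:
  assumes G: "G \<in> alg_aut F A\<^sub>K"
    and nuc: "Nuc_l A\<^sub>K = embedded_field K \<or> Nuc_m A\<^sub>K = embedded_field K \<or> Nuc_r A\<^sub>K = embedded_field K"
  obtains g h b where "g \<in> field_aut F K" "h \<in> field_aut F K" "b \<in> carrier K" "b \<noteq> \<zero>"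
    "\<And>f x. f \<in> {\<sigma>1, \<sigma>2, \<tau>3, \<tau>4} \<Longrightarrow> x \<in> carrier K \<Longrightarrow> g (f x) = f (h x)"
    "g c = \<sigma>1 b \<otimes> \<sigma>2 b \<otimes> c"
    "\<And>u v. u \<in> carrier K \<Longrightarrow> v \<in> carrier K \<Longrightarrow> G (u, v) = (g u, h v \<otimes> b)"
proof -
  have bij: "bij_betw G (carrier K \<times> carrier K) (carrier K \<times> carrier K)"
    using G by (simp add: alg_aut_def)
  have add: "G (u \<oplus> x, v \<oplus> y) = G (u, v) \<oplus>\<^bsub>A\<^sub>K\<^esub> G (x, y)"
    and mult: "G ((u, v) \<otimes>\<^bsub>A\<^sub>K\<^esub> (x, y)) = G (u, v) \<otimes>\<^bsub>A\<^sub>K\<^esub> G (x, y)"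
    if "u \<in> carrier K" "v \<in> carrier K" "x \<in> carrier K" "y \<in> carrier K" for u v x y
    using G that by (auto simp: alg_aut_def simp flip: Cay_simps(3))
  have smult: "G (a \<otimes> u, a \<otimes> v) = a \<odot>\<^bsub>A\<^sub>K\<^esub> G (u, v)"
    if "a \<in> F" "u \<in> carrier K" "v \<in> carrier K" for a u v
    using G that by (auto simp: alg_aut_def simp flip: Cay_simps(4))
  have inj: "inj_on G (carrier K \<times> carrier K)"
    using bij by (auto simp: bij_betw_def)
  have GE: "G ` embedded_field K = embedded_field K"
    using alg_aut_image_Nuc[OF abelian_group_Cay Cay_mult_closed G] nuc by auto

  define g where "g u = fst (G (u, \<zero>))" for u
  have Gu: "G (u, \<zero>) = (g u, \<zero>)" and g_cl: "g u \<in> carrier K" if "u \<in> carrier K" for u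
  proof -
    have "G (u, \<zero>) \<in> embedded_field K"
      using GE that by (auto simp: embedded_field_def)
    then show "G (u, \<zero>) = (g u, \<zero>)" "g u \<in> carrier K"
      by (auto simp: embedded_field_def g_def)
  qed
  have g_add: "g (u \<oplus> x) = g u \<oplus> g x" and g_mult: "g (u \<otimes> x) = g u \<otimes> g x"
    if "u \<in> carrier K" "x \<in> carrier K" for u x
    using add[of u \<zero> x \<zero>] mult[of u \<zero> x \<zero>] that by (auto simp: Gu g_cl)
  have g_inj: "u = x" if "u \<in> carrier K" "x \<in> carrier K" "g u = g x" for u x
    using inj_onD[OF inj, of "(u, \<zero>)" "(x, \<zero>)"] that by (auto simp: Gu)
  have g_im: "g ` carrier K = carrier K"
  proof
    show "carrier K \<subseteq> g ` carrier K"
    proof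
      fix w assume "w \<in> carrier K"
      then have "(w, \<zero>) \<in> G ` embedded_field K"
        by (simp add: GE) (simp add: embedded_field_def)
      then show "w \<in> g ` carrier K"
        by (auto simp: embedded_field_def Gu)
    qed
  qed (auto simp: g_cl)
  \<comment> \<open>Surjectivity is what makes \<open>g \<one>\<close> the unit and not merely an idempotent.\<close>
  have g_one: "g \<one> = \<one>"
  proof -
    obtain e where e: "e \<in> carrier K" "g e = \<one>"
      using g_im one_closed by (metis imageE)
    have "g \<one> = g \<one> \<otimes> g e"
      using e by (simp add: g_cl)
    also have "\<dots> = \<one>"
      using e g_mult[of \<one> e] by simp
    finally show ?thesis .
  qed
  have g [simp]: "g \<in> field_aut F K"
  proof -
    have "g a = a" if "a \<in> F" for a
      using smult[OF that one_closed zero_closed] that F_sub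
      by (auto simp: Gu g_one subset_iff)
    moreover have "g \<in> ring_hom K K"
      by (intro ring_hom_memI g_cl g_add g_mult g_one)
    moreover have "bij_betw g (carrier K) (carrier K)"
      using g_inj g_im by (intro bij_betw_imageI inj_onI)
    ultimately show ?thesis
      by (simp add: field_aut_def ring_iso_def)
  qed
  note [simp] = field_aut_simps[OF g]

  obtain a b where ab: "G (\<zero>, \<one>) = (a, b)"
    by fastforce
  have ab_cl [simp]: "a \<in> carrier K" "b \<in> carrier K"
    using bij_betw_apply[OF bij, of "(\<zero>, \<one>)"] ab by auto
  have b_nonzero: "b \<noteq> \<zero>"
  proof
    assume "b = \<zero>"
    then have "G (\<zero>, \<one>) \<in> G ` embedded_field K"
      by (simp add: GE ab) (simp add: embedded_field_def)
    then have "(\<zero>, \<one>) \<in> embedded_field K"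
      by (subst (asm) inj_on_image_mem_iff[OF inj]) (auto simp: embedded_field_def)
    then show False
      by (simp add: embedded_field_def)
  qed

  define h where "h = \<sigma>3 \<circ> (g \<circ> \<tau>3)"
  have h [simp]: "h \<in> field_aut F K"
    unfolding h_def by (intro field_aut_compose) simp_all
  note [simp] = field_aut_simps[OF h]
  \<comment> \<open>\<open>(\<zero>, v)\<close> is \<open>(\<tau>3 v, \<zero>)\<close> times \<open>(\<zero>, \<one>)\<close>, and also \<open>(\<zero>, \<one>)\<close> times \<open>(\<tau>4 v, \<zero>)\<close>.\<close>
  have Gv: "G (\<zero>, v) = (g (\<tau>3 v) \<otimes> a, h v \<otimes> b)" if "v \<in> carrier K" for v
    using mult[of "\<tau>3 v" \<zero> \<zero> \<one>] that by (simp add: Gu ab h_def)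
  have Gv': "G (\<zero>, v) = (a \<otimes> g (\<tau>4 v), b \<otimes> \<sigma>4 (g (\<tau>4 v)))" if "v \<in> carrier K" for v
    using mult[of \<zero> \<one> "\<tau>4 v" \<zero>] that by (simp add: Gu ab)
  have h4: "h v = \<sigma>4 (g (\<tau>4 v))" if v: "v \<in> carrier K" for v
  proof -
    have "b \<otimes> h v = b \<otimes> \<sigma>4 (g (\<tau>4 v))"
      using Gv[OF v] Gv'[OF v] v by (simp add: m_comm)
    then show ?thesis
      using v b_nonzero by (simp add: m_lcancel)
  qed
  \<comment> \<open>The first component of the image under \<open>G\<close> of the product of \<open>(\<zero>, v)\<close> and \<open>(\<zero>, y)\<close>.\<close>
  have square: "a \<otimes> a \<otimes> (g (\<tau>3 v) \<otimes> g (\<tau>3 y)) \<oplus> c \<otimes> \<sigma>1 b \<otimes> \<sigma>2 b \<otimes> (\<sigma>1 (h v) \<otimes> \<sigma>2 (h y))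
      = g c \<otimes> (g (\<sigma>1 v) \<otimes> g (\<sigma>2 y))"
    if "v \<in> carrier K" "y \<in> carrier K" for v y
    using mult[of \<zero> v \<zero> y] that by (simp add: Gu Gv m_ac)
  have gc: "g c = a \<otimes> a \<oplus> c \<otimes> \<sigma>1 b \<otimes> \<sigma>2 b"
    using square[of \<one> \<one>] by simp
  have gc_nonzero: "a \<otimes> a \<oplus> c \<otimes> \<sigma>1 b \<otimes> \<sigma>2 b \<noteq> \<zero>"
    by (simp flip: gc)

  have a: "a = \<zero>"
  proof (rule ccontr)
    assume a_nonzero: "a \<noteq> \<zero>"
    have "(g \<circ> \<tau>3) v = (g \<circ> \<sigma>1) v" if "v \<in> carrier K" for v
    proof (rule three_characters_agree[of "g \<circ> \<tau>3" "\<sigma>1 \<circ> h" "g \<circ> \<sigma>1"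
          "a \<otimes> a" "c \<otimes> \<sigma>1 b \<otimes> \<sigma>2 b"])
      show "a \<otimes> a \<otimes> (g \<circ> \<tau>3) x \<oplus> c \<otimes> \<sigma>1 b \<otimes> \<sigma>2 b \<otimes> (\<sigma>1 \<circ> h) x
          = (a \<otimes> a \<oplus> c \<otimes> \<sigma>1 b \<otimes> \<sigma>2 b) \<otimes> (g \<circ> \<sigma>1) x" if "x \<in> carrier K" for x
        using square[of x \<one>] that by (simp add: gc)
    qed (use a_nonzero gc_nonzero that in
        \<open>auto intro!: field_aut_hom field_aut_compose simp: integral_iff\<close>)
    then have 1: "\<sigma>1 v = \<tau>3 v" if "v \<in> carrier K" for v
      using that by (metis comp_apply field_aut_simps(1,6) g \<sigma>1 \<tau>_field_aut(1))
    have "(g \<circ> \<tau>3) v = (g \<circ> \<sigma>2) v" if "v \<in> carrier K" for v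
    proof (rule three_characters_agree[of "g \<circ> \<tau>3" "\<sigma>2 \<circ> h" "g \<circ> \<sigma>2"
          "a \<otimes> a" "c \<otimes> \<sigma>1 b \<otimes> \<sigma>2 b"])
      show "a \<otimes> a \<otimes> (g \<circ> \<tau>3) x \<oplus> c \<otimes> \<sigma>1 b \<otimes> \<sigma>2 b \<otimes> (\<sigma>2 \<circ> h) x
          = (a \<otimes> a \<oplus> c \<otimes> \<sigma>1 b \<otimes> \<sigma>2 b) \<otimes> (g \<circ> \<sigma>2) x" if "x \<in> carrier K" for x
        using square[of \<one> x] that by (simp add: gc)
    qed (use a_nonzero gc_nonzero that in
        \<open>auto intro!: field_aut_hom field_aut_compose simp: integral_iff\<close>)
    then have 2: "\<sigma>2 v = \<tau>3 v" if "v \<in> carrier K" for v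
      using that by (metis comp_apply field_aut_simps(1,6) g \<sigma>2 \<tau>_field_aut(1))
    have \<tau>: "\<tau>3 v = \<tau>4 v" if v: "v \<in> carrier K" for v
    proof -
      have "a \<otimes> g (\<tau>3 v) = a \<otimes> g (\<tau>4 v)"
        using Gv[OF v] Gv'[OF v] v by (simp add: m_comm)
      then show ?thesis
        using v a_nonzero by (simp add: m_lcancel)
    qed
    have 4: "\<sigma>4 x = \<sigma>3 x" if "x \<in> carrier K" for x
      using that \<tau>[of "\<sigma>4 x"] by (metis \<tau>_inverse(1,4) field_aut_simps(1) \<sigma>4)
    \<comment> \<open>The algebra is now associative, which makes its nuclei too large.\<close>
    have "associator A\<^sub>K x y z = \<zero>\<^bsub>A\<^sub>K\<^esub>"
      if "x \<in> carrier A\<^sub>K" "y \<in> carrier A\<^sub>K" "z \<in> carrier A\<^sub>K" for x y z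
      using abelian_group.associator_eq_zero_iff[OF abelian_group_Cay Cay_mult_closed that]
        Cay_assoc[OF 1 2 4 that] by blast
    then have "Nuc_l A\<^sub>K = carrier A\<^sub>K" "Nuc_m A\<^sub>K = carrier A\<^sub>K" "Nuc_r A\<^sub>K = carrier A\<^sub>K"
      unfolding Nuc_l_def Nuc_m_def Nuc_r_def by blast+
    then have "carrier A\<^sub>K = embedded_field K"
      using nuc by auto
    then have "(\<zero>, \<one>) \<in> embedded_field K"
      by (metis Cay_simps(1) SigmaI one_closed zero_closed)
    then show False
      by (simp add: embedded_field_def)
  qed

  have gc': "g c = \<sigma>1 b \<otimes> \<sigma>2 b \<otimes> c"
    using gc by (simp add: a m_ac)
  have square': "g c \<otimes> (\<sigma>1 (h v) \<otimes> \<sigma>2 (h y)) = g c \<otimes> (g (\<sigma>1 v) \<otimes> g (\<sigma>2 y))"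
    if "v \<in> carrier K" "y \<in> carrier K" for v y
    using square[OF that] that by (simp add: a gc)
  have "\<sigma>1 (h v) = g (\<sigma>1 v)" "\<sigma>2 (h v) = g (\<sigma>2 v)" if "v \<in> carrier K" for v
    using square'[of v \<one>] square'[of \<one> v] that by (simp_all add: m_lcancel)
  moreover have "g (\<tau>3 v) = \<tau>3 (h v)" if "v \<in> carrier K" for v
    using that by (simp add: h_def)
  moreover have "g (\<tau>4 v) = \<tau>4 (h v)" if "v \<in> carrier K" for v
    using that by (simp add: h4)
  ultimately have comm: "g (f x) = f (h x)" if "f \<in> {\<sigma>1, \<sigma>2, \<tau>3, \<tau>4}" "x \<in> carrier K" for f x
    using that by auto
  have "G (u, v) = (g u, h v \<otimes> b)" if "u \<in> carrier K" "v \<in> carrier K" for u v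
    using add[of u \<zero> \<zero> v] that by (simp add: Gu Gv a)
  with g h ab_cl(2) b_nonzero comm gc' that show thesis
    by blast
qed

lemma alg_autI_normal_form:
  assumes g: "g \<in> field_aut F K" and h: "h \<in> field_aut F K"
    and b: "b \<in> carrier K" "b \<noteq> \<zero>"
    and comm: "\<And>f x. f \<in> {\<sigma>1, \<sigma>2, \<tau>3, \<tau>4} \<Longrightarrow> x \<in> carrier K \<Longrightarrow> g (f x) = f (h x)"
    and gc: "g c = \<sigma>1 b \<otimes> \<sigma>2 b \<otimes> c"
    and G: "\<And>u v. u \<in> carrier K \<Longrightarrow> v \<in> carrier K \<Longrightarrow> G (u, v) = (g u, h v \<otimes> b)"
  shows "G \<in> alg_aut F A\<^sub>K"
proof -
  note [simp] = field_aut_simps[OF g] field_aut_simps[OF h] b G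
  have F [simp]: "x \<in> carrier K" if "x \<in> F" for x
    using that F_sub by blast
  have g1: "g (\<sigma>1 x) = \<sigma>1 (h x)" and g2: "g (\<sigma>2 x) = \<sigma>2 (h x)" if "x \<in> carrier K" for x
    using comm[of \<sigma>1 x] comm[of \<sigma>2 x] that by simp_all
  have h3: "h (\<sigma>3 x) = \<sigma>3 (g x)" if "x \<in> carrier K" for x
    using comm[of \<tau>3 "\<sigma>3 x"] that by simp
  have h4: "h (\<sigma>4 x) = \<sigma>4 (g x)" if "x \<in> carrier K" for x
    using comm[of \<tau>4 "\<sigma>4 x"] that by simp
  have "bij_betw G (carrier K \<times> carrier K) (carrier K \<times> carrier K)"
  proof (intro bij_betw_imageI)
    show "inj_on G (carrier K \<times> carrier K)"
      by (auto simp: inj_on_def m_rcancel)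
    show "G ` (carrier K \<times> carrier K) = carrier K \<times> carrier K"
    proof
      show "carrier K \<times> carrier K \<subseteq> G ` (carrier K \<times> carrier K)"
      proof clarify
        fix x y assume xy: "x \<in> carrier K" "y \<in> carrier K"
        obtain u where u: "u \<in> carrier K" "x = g u"
          using xy field_aut_simps(8)[OF g] by blast
        have "inv b \<in> carrier K"
          using b field_Units by blast
        then have "y \<otimes> inv b \<in> carrier K"
          using xy by simp
        then obtain v where v: "v \<in> carrier K" "h v = y \<otimes> inv b"
          using field_aut_simps(8)[OF h] by (metis imageE)
        have "h v \<otimes> b = y"
          using xy b v by (simp add: m_assoc field_Units)
        then have "(x, y) = G (u, v)"
          using u v by simp
        then show "(x, y) \<in> G ` (carrier K \<times> carrier K)"
          using u v by blast
      qed
    qed auto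
  qed
  then show ?thesis
    by (auto simp: alg_aut_def l_distr r_distr m_ac a_ac g1 g2 gc h3 h4)
qed

end

theorem theorem2p16:
  fixes K :: "('a, 'm) ring_scheme" and F :: "'a set" and c :: 'a
    and \<sigma>1 \<sigma>2 \<sigma>3 \<sigma>4 :: "'a \<Rightarrow> 'a" and G :: "'a \<times> 'a \<Rightarrow> 'a \<times> 'a"
  defines "A\<^sub>K \<equiv> Cay K c \<sigma>1 \<sigma>2 \<sigma>3 \<sigma>4"
  assumes "field K" and "subfield F K" and "ring.finite_dimension K F (carrier K)"
    and "c \<in> carrier K - {\<zero>\<^bsub>K\<^esub>}"
    and "\<sigma>1 \<in> field_aut F K" and "\<sigma>2 \<in> field_aut F K"
    and "\<sigma>3 \<in> field_aut F K" and "\<sigma>4 \<in> field_aut F K"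
    and "Nuc_l A\<^sub>K = embedded_field K \<or> Nuc_m A\<^sub>K = embedded_field K \<or> Nuc_r A\<^sub>K = embedded_field K"
    and "G \<in> carrier A\<^sub>K \<rightarrow> carrier A\<^sub>K"
  shows "G \<in> alg_aut F A\<^sub>K \<longleftrightarrow>
    (\<exists>g\<in>field_aut F K. \<exists>h\<in>field_aut F K. \<exists>b\<in>carrier K - {\<zero>\<^bsub>K\<^esub>}.
       (\<forall>f\<in>{\<sigma>1, \<sigma>2, inv_into (carrier K) \<sigma>3, inv_into (carrier K) \<sigma>4}.
          \<forall>x\<in>carrier K. g (f x) = f (h x))
       \<and> g c = \<sigma>1 b \<otimes>\<^bsub>K\<^esub> \<sigma>2 b \<otimes>\<^bsub>K\<^esub> c
       \<and> (\<forall>u\<in>carrier K. \<forall>v\<in>carrier K. G (u, v) = (g u, h v \<otimes>\<^bsub>K\<^esub> b)))"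
    (is "_ \<longleftrightarrow> ?R")
proof -
  interpret cay_algebra K F c \<sigma>1 \<sigma>2 \<sigma>3 \<sigma>4
    using assms by (auto simp: cay_algebra_def cay_algebra_axioms_def)
  show ?thesis
  proof
    assume "G \<in> alg_aut F A\<^sub>K"
    then have "G \<in> alg_aut F (Cay K c \<sigma>1 \<sigma>2 \<sigma>3 \<sigma>4)"
      by (simp only: A\<^sub>K_def)
    then show ?R
      using assms(10)[unfolded A\<^sub>K_def] by (rule alg_aut_normal_form) blast
  next
    assume ?R
    then show "G \<in> alg_aut F A\<^sub>K"
      unfolding A\<^sub>K_def by (elim bexE conjE, intro alg_autI_normal_form) auto
  qed
qed

end
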